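(* Let $A,B\in \mathbb{R}^{m\times n}$ with $m<n$ and $b\in \mathbb{R}^m$. Suppose that the equation $Ax-B|x|=b$ has a solution $x_*$ and let $s=\operatorname{sign}(x_* )\in\{-1,0,1\}^n$ (entrywise). Let $C=A\operatorname{diag}(s)-B$. Suppose that $x_*$ has no fewer than $\operatorname{rank}(C)$ nonzero entries, and that there are index sets $\mathbb{I}_1\subseteq\{1,\dots,m\}$, $\mathbb{I}_2\subseteq\{1,\dots,n\}$ with $\operatorname{card}(\mathbb{I}_1)=\operatorname{card}(\mathbb{I}_2)=\operatorname{rank}(C)$ such that $C_{(\mathbb{I}_1,\mathbb{I}_2)}$ is nonsingular and $x_{*\mathbb{I}_2}$ has no zero entry. Let $\mathbb{I}_2^{c}=\{1,\dots,n\}\setminus\mathbb{I}_2$. (a) If not all entries of $x_{*\mathbb{I}_2^{c}}$ are $0$, then $Ax-B|x|=b$ has infinitely many solutions with the same sign pattern as $x_*$. (b) $Ax-B|x|=b$ has infinitely many solutions $x$ such that $x_{\mathbb{I}_2}$ has the same sign pattern as $x_{*\mathbb{I}_2}$. (c) If $x_{*\mathbb{I}_2^{c}}=0$, then $Ax-B|x|=b$ has no solution other than $x_*$ with the same sign pattern as $x_*$.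
   Context: $|x|$ is the entrywise absolute value; $\operatorname{diag}(s)$ is the diagonal matrix with diagonal $s$. $\operatorname{sign}(r)=1,0,-1$ for $r>0,r=0,r<0$. A vector $x$ has sign pattern $s$ if $\operatorname{sign}(x_{(i)})=s_{(i)}$ for all $i$. $X_{(\mathbb{I}_1,\mathbb{I}_2)}$ is the submatrix with rows in $\mathbb{I}_1$ and columns in $\mathbb{I}_2$; $x_{\mathbb{I}}$ is the subvector with indices in $\mathbb{I}$; $\operatorname{card}$ is cardinality. *)

theory Defs
  imports "HOL-Analysis.Analysis"
begin

text \<open>Entrywise absolute value of a vector.\<close>
definition vabs :: "real^'n \<Rightarrow> real^'n" where
  "vabs x = (\<chi> i. \<bar>x $ i\<bar>)"

text \<open>Entrywise sign vector (sgn r = 1, 0, -1).\<close>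
definition vsign :: "real^'n \<Rightarrow> real^'n" where
  "vsign x = (\<chi> i. sgn (x $ i))"

text \<open>Diagonal matrix with diagonal s.\<close>
definition diagm :: "real^'n \<Rightarrow> real^'n^'n" where
  "diagm s = (\<chi> i j. if i = j then s $ i else 0)"

text \<open>x solves the absolute value equation A x - B |x| = b.\<close>
definition ave_sol :: "real^'n^'m \<Rightarrow> real^'n^'m \<Rightarrow> real^'m \<Rightarrow> real^'n \<Rightarrow> bool" where
  "ave_sol A B b x \<longleftrightarrow> A *v x - B *v vabs x = b"

text \<open>The square submatrix C_(I1,I2) (card I1 = card I2 assumed separately)
  is nonsingular: its only null vector is 0, i.e. for y supported on I2,
  (C y)_i = 0 for all i in I1 implies y = 0.\<close>
definition nonsingular_sub :: "real^'n^'m \<Rightarrow> 'm set \<Rightarrow> 'n set \<Rightarrow> bool" where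
  "nonsingular_sub C I1 I2 \<longleftrightarrow>
     (\<forall>y::real^'n. (\<forall>j. j \<notin> I2 \<longrightarrow> y $ j = 0) \<longrightarrow>
        (\<forall>i\<in>I1. (\<Sum>j\<in>I2. C $ i $ j * y $ j) = 0) \<longrightarrow> y = 0)"

end

theory Submission
  imports Defs
begin

text \<open>On the orthant of the sign pattern s of x*, the equation reads C |x| = b with
  C = A diag(s) - B. Nonsingularity of the submatrix of C on rows I1 and columns I2 makes C
  injective on vectors supported in I2, and since card I2 = rank C these vectors already exhaust
  the range of C. Part (c) is this injectivity applied to |x| and |x*|. For (a), a column
  j outside I2 in the support of x* is a combination of the columns in I2; this gives a kernel
  vector y of C supported in the support of x*, and x* + t diag(s) y solves the equation with the
  same signs for all small t > 0. For (b), when x* vanishes off I2, the n > m columns of A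
  (off I2) and of C (on I2) are dependent, which gives w \<noteq> 0 vanishing on I2 with A w in the
  range of C; moving from x* in direction w, corrected on I2, keeps solving the equation and
  keeps the signs on I2.\<close>

lemma diagm_mult_vector: "diagm s *v u = (\<chi> i. s$i * u$i)"
  by (simp add: vec_eq_iff matrix_vector_mult_def diagm_def if_distrib[of "\<lambda>a. a * _"] cong: if_cong)

lemma vabs_0 [simp]: "vabs 0 = 0"
  by (simp add: vec_eq_iff vabs_def)

lemma vsign_eq_iff: "vsign x = vsign y \<longleftrightarrow> (\<forall>i. sgn (x$i) = sgn (y$i))"
  by (simp add: vsign_def vec_eq_iff)

lemma diagm_vsign_vabs: "diagm (vsign x) *v vabs x = x"
  by (simp add: vec_eq_iff diagm_mult_vector vsign_def vabs_def sgn_mult_abs)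

lemma ave_sol_iff_sign_system:
  "ave_sol A B b x \<longleftrightarrow> (A ** diagm (vsign x) - B) *v vabs x = b"
  by (simp add: ave_sol_def matrix_vector_mult_diff_rdistrib diagm_vsign_vabs
      flip: matrix_vector_mul_assoc)

lemma nonsingular_sub_inj_on:
  fixes C :: "real^'n^'m"
  assumes "nonsingular_sub C I1 I2"
  shows "inj_on ((*v) C) {z. \<forall>j. j \<notin> I2 \<longrightarrow> z$j = 0}"
proof -
  have "z = 0" if supp: "\<forall>j. j \<notin> I2 \<longrightarrow> z$j = 0" and ker: "C *v z = 0" for z
  proof -
    have "(\<Sum>j\<in>I2. C$i$j * z$j) = (C *v z) $ i" for i
      unfolding matrix_vector_mult_def using supp by (auto intro: sum.mono_neutral_left)
    then show ?thesis
      using assms supp ker unfolding nonsingular_sub_def by simp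
  qed
  then show ?thesis
    by (subst linear_inj_on_iff_eq_0) (auto simp: subspace_def)
qed

lemma image_substandard_eq_range:
  fixes C :: "real^'n^'m"
  assumes card: "card I = rank C" and inj: "inj_on ((*v) C) {z. \<forall>j. j \<notin> I \<longrightarrow> z$j = 0}"
  shows "(*v) C ` {z. \<forall>j. j \<notin> I \<longrightarrow> z$j = 0} = range ((*v) C)"
proof (rule subspace_dim_equal)
  let ?S = "{z::real^'n. \<forall>j. j \<notin> I \<longrightarrow> z$j = 0}"
  have S: "subspace ?S"
    by (auto simp: subspace_def)
  show "subspace ((*v) C ` ?S)"
    using S by (rule linear_subspace_image[OF matrix_vector_mul_linear])
  show "subspace (range ((*v) C))"
    by (rule linear_subspace_image[OF matrix_vector_mul_linear subspace_UNIV])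
  show "(*v) C ` ?S \<subseteq> range ((*v) C)"
    by auto
  have "inj_on ((*v) C) (span ?S)"
    using inj by (simp only: span_eq_iff[THEN iffD2, OF S])
  then have "dim ((*v) C ` ?S) = dim ?S"
    by (rule dim_image_eq[OF matrix_vector_mul_linear])
  also have "\<dots> = card I"
    using dim_substandard_cart[of I, where 'a=real] by (simp add: dim_vec_eq)
  finally show "dim (range ((*v) C)) \<le> dim ((*v) C ` ?S)"
    using card rank_dim_range[of C] by simp
qed

lemma matrix_kernel_nontrivial:
  fixes M :: "real^'n^'m"
  assumes "CARD('m) < CARD('n)"
  obtains x where "x \<noteq> 0" "M *v x = 0"
proof -
  have "\<not> inj ((*v) M)"
    using rank_bound[of M] assms full_rank_injective[of M] by simp
  then obtain x y where "x \<noteq> y" "M *v x = M *v y"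
    by (auto simp: inj_def)
  then show thesis
    using that[of "x - y"] by (simp add: matrix_vector_mult_diff_distrib)
qed

lemma ex_nonzero_vanishing_on_image_in_range:
  fixes A C :: "real^'n^'m"
  assumes "CARD('m) < CARD('n)" and inj: "inj_on ((*v) C) {z. \<forall>j. j \<notin> I \<longrightarrow> z$j = 0}"
  obtains w where "w \<noteq> 0" "\<forall>j\<in>I. w$j = 0" "A *v w \<in> range ((*v) C)"
proof -
  define M :: "real^'n^'m" where "M = (\<chi> i j. if j \<in> I then C$i$j else A$i$j)"
  obtain x where "x \<noteq> 0" "M *v x = 0"
    using assms(1) by (rule matrix_kernel_nontrivial)
  define w where "w = (\<chi> j. if j \<in> I then 0 else x$j)"
  define z where "z = (\<chi> j. if j \<in> I then x$j else 0)"
  have "M *v x = A *v w + C *v z"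
    by (auto simp: vec_eq_iff M_def w_def z_def matrix_vector_mult_def
        simp flip: sum.distrib intro!: sum.cong)
  then have Aw: "A *v w = C *v (- z)"
    using \<open>M *v x = 0\<close> by (simp add: eq_neg_iff_add_eq_0 linear_neg[OF matrix_vector_mul_linear])
  have "w \<noteq> 0"
  proof
    assume "w = 0"
    then have "C *v z = C *v 0"
      using Aw by (simp add: linear_neg[OF matrix_vector_mul_linear])
    then have "z = 0"
      by (rule inj_onD[OF inj]) (auto simp: z_def)
    with \<open>w = 0\<close> \<open>x \<noteq> 0\<close> show False
      by (auto simp: vec_eq_iff w_def z_def split: if_splits)
  qed
  then show thesis
    using that Aw by (auto simp: w_def)
qed

lemma eventually_sgn_add_scaleR:
  fixes x d :: "real^'n"
  shows "\<forall>\<^sub>F t in at_right 0. \<forall>i. x$i \<noteq> 0 \<longrightarrow> sgn ((x + t *\<^sub>R d) $ i) = sgn (x$i)"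
proof (rule eventually_all_finite)
  fix i
  have "((\<lambda>t. \<bar>t * d$i\<bar>) \<longlongrightarrow> 0) (at_right 0)"
    by (auto intro!: tendsto_eq_intros)
  from order_tendstoD(2)[OF this, of "\<bar>x$i\<bar>"]
  have "\<forall>\<^sub>F t in at_right 0. x$i \<noteq> 0 \<longrightarrow> \<bar>t * d$i\<bar> < \<bar>x$i\<bar>"
    by (cases "x$i = 0") auto
  then show "\<forall>\<^sub>F t in at_right 0. x$i \<noteq> 0 \<longrightarrow> sgn ((x + t *\<^sub>R d) $ i) = sgn (x$i)"
    by eventually_elim (auto simp: sgn_if abs_if split: if_splits)
qed

text \<open>\<open>w\<close> moves the zero entries of \<open>x\<close> and \<open>diagm (vsign x) *v y\<close> the nonzero ones; as long as
  the nonzero entries keep their signs, \<open>vabs\<close> is affine along the ray.\<close>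

lemma eventually_vabs_add_scaleR:
  fixes x w y :: "real^'n"
  assumes "\<forall>i. x$i \<noteq> 0 \<longrightarrow> w$i = 0" and "\<forall>i. x$i = 0 \<longrightarrow> y$i = 0"
  shows "\<forall>\<^sub>F t in at_right 0.
           vabs (x + t *\<^sub>R (w + diagm (vsign x) *v y)) = vabs x + t *\<^sub>R (vabs w + y)"
  using eventually_sgn_add_scaleR[of x "w + diagm (vsign x) *v y"] eventually_at_right_less
proof eventually_elim
  case (elim t)
  show ?case
  proof (rule vec_eq_iff[THEN iffD2], rule allI)
    fix i
    let ?v = "(x + t *\<^sub>R (w + diagm (vsign x) *v y)) $ i"
    show "vabs (x + t *\<^sub>R (w + diagm (vsign x) *v y)) $ i = (vabs x + t *\<^sub>R (vabs w + y)) $ i"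
    proof (cases "x$i = 0")
      case True
      then show ?thesis
        using assms(2) \<open>0 < t\<close> by (simp add: vabs_def diagm_mult_vector abs_mult)
    next
      case False
      then have "\<bar>?v\<bar> = sgn (x$i) * ?v"
        using elim(1) by (simp add: abs_sgn mult.commute)
      then show ?thesis
        using False assms(1) abs_sgn[of "x$i"]
        by (simp add: vabs_def vsign_def diagm_mult_vector algebra_simps abs_sgn_eq)
    qed
  qed
qed

lemma eventually_ave_sol_add_scaleR:
  assumes sol: "ave_sol A B b x"
    and "\<forall>i. x$i \<noteq> 0 \<longrightarrow> w$i = 0" and "\<forall>i. x$i = 0 \<longrightarrow> y$i = 0"
    and dir: "A *v w - B *v vabs w + (A ** diagm (vsign x) - B) *v y = 0"
  shows "\<forall>\<^sub>F t in at_right 0. ave_sol A B b (x + t *\<^sub>R (w + diagm (vsign x) *v y))"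
  using eventually_vabs_add_scaleR[OF assms(2,3)]
proof eventually_elim
  case (elim t)
  have "A *v (x + t *\<^sub>R (w + diagm (vsign x) *v y)) - B *v (vabs x + t *\<^sub>R (vabs w + y))
      = (A *v x - B *v vabs x) + t *\<^sub>R (A *v w - B *v vabs w + (A ** diagm (vsign x) - B) *v y)"
    by (simp add: algebra_simps matrix_vector_mul_assoc)
  then show ?case
    using sol dir elim by (simp add: ave_sol_def)
qed

lemma infinite_if_eventually_along_ray:
  fixes x d :: "'a::real_vector"
  assumes "d \<noteq> 0" and "\<forall>\<^sub>F t in at_right 0. P (x + t *\<^sub>R d)"
  shows "infinite {z. P z}"
proof -
  obtain e :: real where "e > 0" and P: "\<And>t. 0 < t \<Longrightarrow> t < e \<Longrightarrow> P (x + t *\<^sub>R d)"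
    using assms(2) by (auto simp: eventually_at_right_field)
  have "inj_on (\<lambda>t. x + t *\<^sub>R d) {0<..<e}"
    using assms(1) by (auto simp: inj_on_def)
  then have "infinite ((\<lambda>t. x + t *\<^sub>R d) ` {0<..<e})"
    using \<open>e > 0\<close> by (simp add: finite_image_iff)
  moreover have "(\<lambda>t. x + t *\<^sub>R d) ` {0<..<e} \<subseteq> {z. P z}"
    using P by auto
  ultimately show ?thesis
    using infinite_super by blast
qed

lemma ex_kernel_vector_with_unit_entry:
  fixes C :: "real^'n^'m"
  assumes "(*v) C ` {z. \<forall>i. i \<notin> I \<longrightarrow> z$i = 0} = range ((*v) C)" and "j \<notin> I"
  obtains y where "C *v y = 0" "y$j = 1" "\<forall>i. i \<noteq> j \<and> i \<notin> I \<longrightarrow> y$i = 0"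
proof -
  have "C *v axis j 1 \<in> (*v) C ` {z. \<forall>i. i \<notin> I \<longrightarrow> z$i = 0}"
    using assms(1) by simp
  then obtain z where z: "\<forall>i. i \<notin> I \<longrightarrow> z$i = 0" "C *v z = C *v axis j 1"
    by auto
  show thesis
    by (rule that[of "axis j 1 - z"])
      (use z assms(2) in \<open>auto simp: matrix_vector_mult_diff_distrib axis_def\<close>)
qed

lemma infinite_ave_sol_same_sign:
  fixes A B :: "real^'n^'m" and xs :: "real^'n"
  defines "C \<equiv> A ** diagm (vsign xs) - B"
  assumes sol: "ave_sol A B b xs"
    and range: "(*v) C ` {z. \<forall>i. i \<notin> I \<longrightarrow> z$i = 0} = range ((*v) C)"
    and supp_I: "\<forall>i\<in>I. xs$i \<noteq> 0" and "j \<notin> I" and "xs$j \<noteq> 0"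
  shows "infinite {x. ave_sol A B b x \<and> vsign x = vsign xs}"
proof -
  obtain y where ker: "C *v y = 0" and "y$j = 1" and y_supp: "\<forall>i. i \<noteq> j \<and> i \<notin> I \<longrightarrow> y$i = 0"
    using range \<open>j \<notin> I\<close> by (rule ex_kernel_vector_with_unit_entry)
  have supp: "\<forall>i. xs$i = 0 \<longrightarrow> y$i = 0"
    using y_supp supp_I \<open>xs$j \<noteq> 0\<close> by auto
  show ?thesis
  proof (rule infinite_if_eventually_along_ray)
    let ?d = "diagm (vsign xs) *v y"
    have "?d $ j \<noteq> 0"
      using \<open>y$j = 1\<close> \<open>xs$j \<noteq> 0\<close> by (simp add: diagm_mult_vector vsign_def sgn_zero_iff)
    then show "?d \<noteq> 0"
      by (metis zero_index)
    have "\<forall>\<^sub>F t in at_right 0. ave_sol A B b (xs + t *\<^sub>R ?d)"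
      using eventually_ave_sol_add_scaleR[OF sol, of 0 y] supp ker by (simp add: C_def)
    then show "\<forall>\<^sub>F t in at_right 0. ave_sol A B b (xs + t *\<^sub>R ?d) \<and> vsign (xs + t *\<^sub>R ?d) = vsign xs"
      using eventually_sgn_add_scaleR[of xs ?d]
    proof eventually_elim
      case (elim t)
      have "sgn ((xs + t *\<^sub>R ?d) $ i) = sgn (xs $ i)" for i
        using elim(2) by (cases "xs$i = 0") (simp_all add: diagm_mult_vector vsign_def)
      with elim(1) show ?case
        by (simp add: vsign_eq_iff)
    qed
  qed
qed

lemma infinite_ave_sol_same_sign_on_support:
  fixes A B :: "real^'n^'m" and xs :: "real^'n"
  defines "C \<equiv> A ** diagm (vsign xs) - B" and "S \<equiv> {z. \<forall>i. xs$i = 0 \<longrightarrow> z$i = 0}"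
  assumes "CARD('m) < CARD('n)" and sol: "ave_sol A B b xs"
    and inj: "inj_on ((*v) C) S" and range: "(*v) C ` S = range ((*v) C)"
  shows "infinite {x. ave_sol A B b x \<and> (\<forall>i. xs$i \<noteq> 0 \<longrightarrow> sgn (x$i) = sgn (xs$i))}"
proof -
  have "inj_on ((*v) C) {z. \<forall>j. j \<notin> {i. xs$i \<noteq> 0} \<longrightarrow> z$j = 0}"
    using inj by (simp add: S_def)
  with \<open>CARD('m) < CARD('n)\<close> obtain w
    where "w \<noteq> 0" and off_supp: "\<forall>i. xs$i \<noteq> 0 \<longrightarrow> w$i = 0" and "A *v w \<in> range ((*v) C)"
    by (rule ex_nonzero_vanishing_on_image_in_range) auto
  have sub: "subspace (range ((*v) C))"
    by (rule linear_subspace_image[OF matrix_vector_mul_linear subspace_UNIV])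
  have "diagm (vsign xs) *v vabs w = 0"
    using off_supp by (auto simp: vec_eq_iff diagm_mult_vector vsign_def vabs_def sgn_zero_iff)
  then have "C *v vabs w = - (B *v vabs w)"
    by (simp add: C_def matrix_vector_mult_diff_rdistrib flip: matrix_vector_mul_assoc)
  then have "B *v vabs w \<in> range ((*v) C)"
    using subspace_neg[OF sub rangeI, of "vabs w"] by simp
  then have "- (A *v w - B *v vabs w) \<in> range ((*v) C)"
    using \<open>A *v w \<in> range ((*v) C)\<close> by (intro subspace_neg[OF sub] subspace_diff[OF sub])
  then have "- (A *v w - B *v vabs w) \<in> (*v) C ` S"
    using range by simp
  then obtain y where supp: "\<forall>i. xs$i = 0 \<longrightarrow> y$i = 0" and y: "C *v y = - (A *v w - B *v vabs w)"
    by (auto simp: S_def)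
  show ?thesis
  proof (rule infinite_if_eventually_along_ray)
    let ?d = "w + diagm (vsign xs) *v y"
    obtain i where "w$i \<noteq> 0"
      using \<open>w \<noteq> 0\<close> by (auto simp: vec_eq_iff)
    moreover have "xs$i = 0"
      using off_supp \<open>w$i \<noteq> 0\<close> by blast
    ultimately have "?d $ i \<noteq> 0"
      by (simp add: diagm_mult_vector vsign_def)
    then show "?d \<noteq> 0"
      by (metis zero_index)
    have "\<forall>\<^sub>F t in at_right 0. ave_sol A B b (xs + t *\<^sub>R ?d)"
      using eventually_ave_sol_add_scaleR[OF sol off_supp supp] y by (simp add: C_def)
    then show "\<forall>\<^sub>F t in at_right 0. ave_sol A B b (xs + t *\<^sub>R ?d) \<and>
        (\<forall>i. xs$i \<noteq> 0 \<longrightarrow> sgn ((xs + t *\<^sub>R ?d) $ i) = sgn (xs$i))"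
      using eventually_sgn_add_scaleR[of xs ?d] by eventually_elim simp
  qed
qed

lemma ave_sol_same_sign_unique:
  assumes "ave_sol A B b x" and "ave_sol A B b xs" and sign: "vsign x = vsign xs"
    and inj: "inj_on ((*v) (A ** diagm (vsign xs) - B)) {z. \<forall>i. xs$i = 0 \<longrightarrow> z$i = 0}"
  shows "x = xs"
proof -
  have zero_iff: "x$i = 0 \<longleftrightarrow> xs$i = 0" for i
    using sign by (metis sgn_zero_iff vsign_eq_iff)
  have "(A ** diagm (vsign xs) - B) *v vabs x = (A ** diagm (vsign xs) - B) *v vabs xs"
    using assms(1,2) sign by (simp add: ave_sol_iff_sign_system)
  then have "vabs x = vabs xs"
    by (rule inj_onD[OF inj]) (auto simp: vabs_def zero_iff)
  then show ?thesis
    using sign diagm_vsign_vabs by metis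
qed

theorem theorem3p3:
  fixes A B :: "real^'n^'m" and b :: "real^'m" and xs :: "real^'n"
    and I1 :: "'m set" and I2 :: "'n set"
  assumes mn: "CARD('m) < CARD('n)"
    and sol: "ave_sol A B b xs"
    and nnz: "card {i. xs $ i \<noteq> 0} \<ge> rank (A ** diagm (vsign xs) - B)"
    and c1: "card I1 = rank (A ** diagm (vsign xs) - B)"
    and c2: "card I2 = rank (A ** diagm (vsign xs) - B)"
    and ns: "nonsingular_sub (A ** diagm (vsign xs) - B) I1 I2"
    and nz: "\<forall>j\<in>I2. xs $ j \<noteq> 0"
  shows "((\<exists>j\<in>- I2. xs $ j \<noteq> 0) \<longrightarrow>
            infinite {x. ave_sol A B b x \<and> vsign x = vsign xs})
       \<and> infinite {x. ave_sol A B b x \<and> (\<forall>j\<in>I2. sgn (x $ j) = sgn (xs $ j))}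
       \<and> ((\<forall>j\<in>- I2. xs $ j = 0) \<longrightarrow>
            (\<forall>x. ave_sol A B b x \<and> vsign x = vsign xs \<longrightarrow> x = xs))"
proof -
  let ?C = "A ** diagm (vsign xs) - B"
  let ?S = "{z. \<forall>j. j \<notin> I2 \<longrightarrow> z$j = 0}"
  have inj: "inj_on ((*v) ?C) ?S"
    using ns by (rule nonsingular_sub_inj_on)
  have range: "(*v) ?C ` ?S = range ((*v) ?C)"
    using c2 inj by (rule image_substandard_eq_range)
  have a: "infinite {x. ave_sol A B b x \<and> vsign x = vsign xs}" if "\<exists>j\<in>- I2. xs $ j \<noteq> 0"
    using that infinite_ave_sol_same_sign[OF sol range nz] by blast
  have b: "infinite {x. ave_sol A B b x \<and> (\<forall>j\<in>I2. sgn (x $ j) = sgn (xs $ j))}"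
  proof (cases "\<exists>j\<in>- I2. xs $ j \<noteq> 0")
    case True
    then show ?thesis
      by (rule a[THEN infinite_super[rotated]]) (auto simp: vsign_eq_iff)
  next
    case False
    then have "xs$i = 0 \<longleftrightarrow> i \<notin> I2" for i
      using nz by blast
    then have "infinite {x. ave_sol A B b x \<and> (\<forall>i. xs$i \<noteq> 0 \<longrightarrow> sgn (x$i) = sgn (xs$i))}"
      using infinite_ave_sol_same_sign_on_support[OF mn sol] inj range by simp
    then show ?thesis
      by (rule infinite_super[rotated]) (use nz in auto)
  qed
  have c: "\<forall>x. ave_sol A B b x \<and> vsign x = vsign xs \<longrightarrow> x = xs" if "\<forall>j\<in>- I2. xs $ j = 0"
  proof -
    have "inj_on ((*v) ?C) {z. \<forall>i. xs$i = 0 \<longrightarrow> z$i = 0}"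
      using inj by (rule inj_on_subset) (use that in auto)
    then show ?thesis
      using ave_sol_same_sign_unique[OF _ sol] by blast
  qed
  show ?thesis
    using b by (intro conjI impI a c)
qed

end
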